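(* The property of being finitely annihilated (as a property of finitely presented groups) is neither a Markov property nor a co-Markov property.
   Context: An element $g$ of a group $G$ is finitely annihilated if there is a finite group $H_g$ and a homomorphism $\phi_g: G\to H_g$ with $\phi_g(g)=e$ and $\mathrm{Im}(\phi_g)\neq\{e\}$. A non-trivial group $G$ is finitely annihilated (F-A) if all its non-trivial elements are finitely annihilated; equivalently, $G$ is the union of all its proper, normal, finite index subgroups. The trivial group is by convention not F-A. An algebraic (i.e. isomorphism-invariant) property $\rho$ of finitely presented groups is a Markov property if there exist two finitely presented groups $G_+,G_-$ such that (1) $G_+$ has the property $\rho$; (2) $G_-$ does not have the property $\rho$, nor does it embed into any finitely presented group with the property $\rho$. A property $\rho$ is co-Markov if its complement "not $\rho$" is a Markov property. *)

theory Defs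
  imports "HOL-Algebra.Weak_Morphisms" "HOL-Library.Countable_Set"
begin

section \<open>Free groups\<close>

text \<open>A letter \<open>(x, True)\<close> stands for the generator \<open>x\<close>, a letter \<open>(x, False)\<close>
  for its formal inverse.\<close>

type_synonym 'x word = "('x \<times> bool) list"

definition words :: "'x set \<Rightarrow> 'x word set" where
  "words S = lists (S \<times> UNIV)"

inductive_set free_equiv :: "'x set \<Rightarrow> ('x word \<times> 'x word) set" for S where
  refl: "w \<in> words S \<Longrightarrow> (w, w) \<in> free_equiv S"
| sym: "(u, v) \<in> free_equiv S \<Longrightarrow> (v, u) \<in> free_equiv S"
| trans: "(u, v) \<in> free_equiv S \<Longrightarrow> (v, w) \<in> free_equiv S \<Longrightarrow> (u, w) \<in> free_equiv S"
| cancel: "u \<in> words S \<Longrightarrow> v \<in> words S \<Longrightarrow> x \<in> S \<Longrightarrow>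
    (u @ [(x, b), (x, \<not> b)] @ v, u @ v) \<in> free_equiv S"

definition free_group :: "'x set \<Rightarrow> 'x word set monoid" where
  "free_group S =
    \<lparr>carrier = words S // free_equiv S,
     mult = (\<lambda>A B. \<Union>u\<in>A. \<Union>v\<in>B. free_equiv S `` {u @ v}),
     one = free_equiv S `` {[]}\<rparr>"

lemma free_equiv_words: "(u, v) \<in> free_equiv S \<Longrightarrow> u \<in> words S \<and> v \<in> words S"
  by (induction rule: free_equiv.induct) (auto simp: words_def)

lemma equiv_free_equiv: "equiv (words S) (free_equiv S)"
proof (rule equivI)
  show "free_equiv S \<subseteq> words S \<times> words S"
    by (auto dest: free_equiv_words)
  show "refl_on (words S) (free_equiv S)"
    by (auto simp: refl_on_def free_equiv.refl)
  show "sym (free_equiv S)" by (auto simp: sym_def intro: free_equiv.sym)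
  show "Relation.trans (free_equiv S)" unfolding Relation.trans_def by (blast intro: free_equiv.trans)
qed

lemma free_equiv_context:
  assumes "(u, v) \<in> free_equiv S" "p \<in> words S" "q \<in> words S"
  shows "(p @ u @ q, p @ v @ q) \<in> free_equiv S"
  using assms(1)
proof (induction rule: free_equiv.induct)
  case (refl w)
  then show ?case using assms(2,3) by (intro free_equiv.refl) (auto simp: words_def)
next
  case (sym u v)
  then show ?case by (blast intro: free_equiv.sym)
next
  case (trans u v w)
  then show ?case by (blast intro: free_equiv.trans)
next
  case (cancel u v x b)
  have "p @ u \<in> words S" "v @ q \<in> words S"
    using cancel assms(2,3) by (auto simp: words_def)
  from free_equiv.cancel[OF this cancel(3), of b] show ?case by simp
qed

lemma free_equiv_append:
  assumes "(u, u') \<in> free_equiv S" "(v, v') \<in> free_equiv S"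
  shows "(u @ v, u' @ v') \<in> free_equiv S"
proof -
  have "(u @ v, u' @ v) \<in> free_equiv S"
    using free_equiv_context[OF assms(1), of "[]" v] free_equiv_words[OF assms(2)]
    by (simp add: words_def)
  moreover have "(u' @ v, u' @ v') \<in> free_equiv S"
    using free_equiv_context[OF assms(2), of u' "[]"] free_equiv_words[OF assms(1)]
    by (simp add: words_def)
  ultimately show ?thesis by (rule free_equiv.trans)
qed

lemma free_group_mult_class:
  assumes "u \<in> words S" "v \<in> words S"
  shows "free_equiv S `` {u} \<otimes>\<^bsub>free_group S\<^esub> free_equiv S `` {v} = free_equiv S `` {u @ v}"
proof -
  have "congruent2 (free_equiv S) (free_equiv S) (\<lambda>u v. free_equiv S `` {u @ v})"
    by (intro congruent2I'[where f = "\<lambda>u v. free_equiv S `` {u @ v}"]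
        equiv_class_eq[OF equiv_free_equiv] free_equiv_append)
  then show ?thesis
    using UN_equiv_class2[OF equiv_free_equiv equiv_free_equiv _ assms]
    by (simp add: free_group_def)
qed

lemma free_equiv_inverse:
  assumes "w \<in> words S"
  shows "(rev (map (map_prod id Not) w) @ w, []) \<in> free_equiv S"
  using assms
proof (induction w)
  case Nil
  then show ?case by (auto simp: words_def intro!: free_equiv.refl)
next
  case (Cons a w)
  obtain x b where a: "a = (x, b)" by fastforce
  have w: "w \<in> words S" "x \<in> S" using Cons.prems a by (auto simp: words_def)
  have r: "rev (map (map_prod id Not) w) \<in> words S"
    using w by (fastforce simp: words_def)
  from free_equiv.cancel[OF r w(1) w(2), of "\<not> b"]
  have "(rev (map (map_prod id Not) (a # w)) @ a # w,
      rev (map (map_prod id Not) w) @ w) \<in> free_equiv S"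
    by (simp add: a)
  then show ?case using Cons.IH[OF w(1)] by (rule free_equiv.trans)
qed

lemma group_free_group: "group (free_group S)"
proof (rule groupI)
  let ?G = "free_group S" and ?c = "\<lambda>w. free_equiv S `` {w}"
  have c: "?c w \<in> carrier ?G" if "w \<in> words S" for w
    using that by (auto simp: free_group_def intro: quotientI)
  have ex: "\<exists>w\<in>words S. a = ?c w" if "a \<in> carrier ?G" for a
    using that by (auto simp: free_group_def elim: quotientE)
  have app: "u @ v \<in> words S" if "u \<in> words S" "v \<in> words S" for u v
    using that by (auto simp: words_def)
  have nil: "[] \<in> words S" by (simp add: words_def)
  have one: "\<one>\<^bsub>?G\<^esub> = ?c []" by (simp add: free_group_def)
  show "\<one>\<^bsub>?G\<^esub> \<in> carrier ?G" using c[OF nil] one by simp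
  fix a assume "a \<in> carrier ?G"
  then obtain u where u: "u \<in> words S" "a = ?c u" using ex by blast
  show "\<one>\<^bsub>?G\<^esub> \<otimes>\<^bsub>?G\<^esub> a = a" using u nil by (simp add: one free_group_mult_class)
  let ?u = "rev (map (map_prod id Not) u)"
  have u': "?u \<in> words S" using u by (fastforce simp: words_def)
  have "?c ?u \<otimes>\<^bsub>?G\<^esub> a = \<one>\<^bsub>?G\<^esub>"
    using equiv_class_eq[OF equiv_free_equiv free_equiv_inverse[OF u(1)]] u u'
    by (simp add: one free_group_mult_class)
  then show "\<exists>b\<in>carrier ?G. b \<otimes>\<^bsub>?G\<^esub> a = \<one>\<^bsub>?G\<^esub>" using c[OF u'] by blast
  fix b assume "b \<in> carrier ?G"
  then obtain v where v: "v \<in> words S" "b = ?c v" using ex by blast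
  show "a \<otimes>\<^bsub>?G\<^esub> b \<in> carrier ?G" using u v c app by (simp add: free_group_mult_class)
  fix d assume "d \<in> carrier ?G"
  then obtain w where w: "w \<in> words S" "d = ?c w" using ex by blast
  show "a \<otimes>\<^bsub>?G\<^esub> b \<otimes>\<^bsub>?G\<^esub> d = a \<otimes>\<^bsub>?G\<^esub> (b \<otimes>\<^bsub>?G\<^esub> d)"
    using u v w app by (simp add: free_group_mult_class)
qed


section \<open>Finitely presented groups\<close>

definition normal_closure :: "('a, 'b) monoid_scheme \<Rightarrow> 'a set \<Rightarrow> 'a set" where
  "normal_closure G R = \<Inter>{N. N \<lhd> G \<and> R \<subseteq> N}"

lemma normal_closure_normal:
  assumes "group G" "R \<subseteq> carrier G"
  shows "normal_closure G R \<lhd> G"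
proof -
  interpret group G by fact
  let ?F = "{N. N \<lhd> G \<and> R \<subseteq> N}"
  have "carrier G \<lhd> G"
    by (auto simp: normal_inv_iff subgroup_self)
  then have ne: "carrier G \<in> ?F" using assms(2) by blast
  have "subgroup (\<Inter>?F) G"
    using ne by (intro subgroups_Inter) (auto dest: normal_imp_subgroup)
  then show ?thesis
    unfolding normal_closure_def normal_inv_iff by (auto simp: normal_inv_iff)
qed

text \<open>Only the number of generators matters, so they may be taken to be natural numbers.\<close>

definition finitely_presented :: "('a, 'b) monoid_scheme \<Rightarrow> bool" where
  "finitely_presented G \<longleftrightarrow> group G \<and>
    (\<exists>(S :: nat set) R. finite S \<and> R \<subseteq> carrier (free_group S) \<and> finite R \<and>
      G \<cong> free_group S Mod normal_closure (free_group S) R)"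

lemma finitely_presented_iso:
  assumes "finitely_presented G" "group H" "G \<cong> H"
  shows "finitely_presented H"
  using assms group.iso_sym iso_trans unfolding finitely_presented_def by metis

text \<open>Finitely presented groups are countable, so every one of them has an isomorphic copy
  with natural numbers as elements.\<close>

lemma group_nat_copy:
  assumes "group G" "countable (carrier G)"
  shows "\<exists>H :: nat monoid. group H \<and> G \<cong> H"
proof -
  interpret group G by fact
  let ?f = "to_nat_on (carrier G)"
  have inj: "inj_on ?f (carrier G)" using assms(2) by (rule inj_on_to_nat_on)
  have iso: "?f \<in> iso G (image_group ?f G)"
    using inj by (auto simp: iso_def hom_def bij_betw_def image_group_def)
  have "group ((image_group ?f G)\<lparr>one := ?f \<one>\<^bsub>G\<^esub>\<rparr>)"
    using iso by (rule iso_imp_img_group)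
  then have "group (image_group ?f G)" by (simp add: image_group_def)
  with iso show ?thesis using is_isoI by blast
qed

lemma finitely_presented_nat_copy:
  assumes "finitely_presented G"
  shows "\<exists>H :: nat monoid. finitely_presented H \<and> G \<cong> H"
proof -
  from assms obtain S :: "nat set" and R where G: "group G"
    and iso: "G \<cong> free_group S Mod normal_closure (free_group S) R"
    unfolding finitely_presented_def by blast
  have "carrier (free_group S) \<subseteq> (\<lambda>w. free_equiv S `` {w}) ` UNIV"
    by (auto simp: free_group_def quotient_def)
  then have "countable (carrier (free_group S))"
    by (meson countable_image countable_subset countableI_type)
  then have "countable (carrier (free_group S Mod normal_closure (free_group S) R))"
    unfolding FactGroup_def RCOSETS_def by simp
  moreover obtain h where "bij_betw h (carrier G)
      (carrier (free_group S Mod normal_closure (free_group S) R))"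
    using iso by (auto simp: is_iso_def iso_def)
  ultimately have "countable (carrier G)"
    by (metis bij_betw_def countable_image_inj_on)
  then show ?thesis
    using group_nat_copy[OF G] finitely_presented_iso[OF assms] by blast
qed


section \<open>Finitely annihilated groups\<close>

text \<open>The finite target group may be taken to have natural numbers as elements;
  lemma \<open>finitely_annihilated_elementI\<close> shows that this is no restriction.\<close>

definition finitely_annihilated_element :: "('a, 'b) monoid_scheme \<Rightarrow> 'a \<Rightarrow> bool" where
  "finitely_annihilated_element G g \<longleftrightarrow>
    (\<exists>(H :: nat monoid) \<phi>. group H \<and> finite (carrier H) \<and> \<phi> \<in> hom G H \<and>
      \<phi> g = \<one>\<^bsub>H\<^esub> \<and> \<phi> ` carrier G \<noteq> {\<one>\<^bsub>H\<^esub>})"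

definition finitely_annihilated :: "('a, 'b) monoid_scheme \<Rightarrow> bool" where
  "finitely_annihilated G \<longleftrightarrow> group G \<and> carrier G \<noteq> {\<one>\<^bsub>G\<^esub>} \<and>
    (\<forall>g\<in>carrier G. g \<noteq> \<one>\<^bsub>G\<^esub> \<longrightarrow> finitely_annihilated_element G g)"

lemma finitely_annihilated_elementI:
  fixes H :: "('c, 'd) monoid_scheme"
  assumes "group G" "group H" "finite (carrier H)" "\<phi> \<in> hom G H"
    and "\<phi> g = \<one>\<^bsub>H\<^esub>" "\<phi> ` carrier G \<noteq> {\<one>\<^bsub>H\<^esub>}"
  shows "finitely_annihilated_element G g"
proof -
  obtain K :: "nat monoid" where K: "group K" "H \<cong> K"
    using group_nat_copy[OF assms(2)] assms(3) countable_finite by blast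
  then obtain h where h: "h \<in> iso H K" by (auto simp: is_iso_def)
  then have hom: "h \<in> hom H K" and bij: "bij_betw h (carrier H) (carrier K)"
    by (auto simp: iso_def)
  have h1: "h \<one>\<^bsub>H\<^esub> = \<one>\<^bsub>K\<^esub>" using hom assms(2) K(1) by (rule hom_one)
  have sub: "\<phi> ` carrier G \<subseteq> carrier H" using assms(4) by (auto simp: hom_def)
  have "(h \<circ> \<phi>) ` carrier G \<noteq> {\<one>\<^bsub>K\<^esub>}"
  proof
    assume "(h \<circ> \<phi>) ` carrier G = {\<one>\<^bsub>K\<^esub>}"
    then have "h ` (\<phi> ` carrier G) = h ` {\<one>\<^bsub>H\<^esub>}" by (simp add: image_comp h1)
    moreover have "{\<one>\<^bsub>H\<^esub>} \<subseteq> carrier H" using assms(2) by (simp add: group.is_monoid)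
    ultimately have "\<phi> ` carrier G = {\<one>\<^bsub>H\<^esub>}"
      using sub bij inj_on_image_eq_iff by (metis bij_betw_def)
    then show False using assms(6) by contradiction
  qed
  moreover have "h \<circ> \<phi> \<in> hom G K" using assms(4) hom by (rule hom_compose)
  moreover have "finite (carrier K)" using bij assms(3) bij_betw_finite by blast
  ultimately show ?thesis
    using K(1) h1 assms(5) unfolding finitely_annihilated_element_def
    by (intro exI[of _ K] exI[of _ "h \<circ> \<phi>"]) auto
qed

lemma finitely_annihilated_iso_imp:
  assumes "finitely_annihilated G" "group H" "G \<cong> H"
  shows "finitely_annihilated H"
proof -
  have G: "group G" and nt: "carrier G \<noteq> {\<one>\<^bsub>G\<^esub>}"
    using assms(1) by (auto simp: finitely_annihilated_def)
  interpret G: group G by fact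
  interpret H: group H by fact
  obtain h where "h \<in> iso H G"
    using G.iso_sym[OF assms(3)] by (auto simp: is_iso_def)
  then have hom: "h \<in> hom H G" and bij: "bij_betw h (carrier H) (carrier G)"
    by (auto simp: iso_def)
  have im: "h ` carrier H = carrier G" and inj: "inj_on h (carrier H)"
    using bij by (auto simp: bij_betw_def)
  have h1: "h \<one>\<^bsub>H\<^esub> = \<one>\<^bsub>G\<^esub>" using hom assms(2) G by (rule hom_one)
  have "carrier H \<noteq> {\<one>\<^bsub>H\<^esub>}" using im h1 nt by auto
  moreover have "finitely_annihilated_element H x" if x: "x \<in> carrier H" "x \<noteq> \<one>\<^bsub>H\<^esub>" for x
  proof -
    have "h x \<in> carrier G" "h x \<noteq> \<one>\<^bsub>G\<^esub>"
      using x im inj h1 by (auto, metis H.one_closed inj_onD)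
    then obtain K :: "nat monoid" and \<phi> where K: "group K" "finite (carrier K)" "\<phi> \<in> hom G K"
      "\<phi> (h x) = \<one>\<^bsub>K\<^esub>" "\<phi> ` carrier G \<noteq> {\<one>\<^bsub>K\<^esub>}"
      using assms(1) unfolding finitely_annihilated_def finitely_annihilated_element_def by blast
    have "(\<phi> \<circ> h) ` carrier H \<noteq> {\<one>\<^bsub>K\<^esub>}" using K(5) im by (metis image_comp)
    then show ?thesis
      using K hom_compose[OF hom K(3)] unfolding finitely_annihilated_element_def
      by (intro exI[of _ K] exI[of _ "\<phi> \<circ> h"]) auto
  qed
  ultimately show ?thesis using assms(2) by (auto simp: finitely_annihilated_def)
qed


section \<open>Markov properties\<close>

text \<open>A property of finitely presented groups is a predicate on \<^typ>\<open>nat monoid\<close>, of which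
  only the values on finitely presented groups matter.  By \<open>finitely_presented_nat_copy\<close> this
  type contains every finitely presented group up to isomorphism.\<close>

definition algebraic_property :: "(nat monoid \<Rightarrow> bool) \<Rightarrow> bool" where
  "algebraic_property \<rho> \<longleftrightarrow>
    (\<forall>G H. finitely_presented G \<longrightarrow> finitely_presented H \<longrightarrow> G \<cong> H \<longrightarrow> \<rho> G = \<rho> H)"

definition embeds :: "('a, 'c) monoid_scheme \<Rightarrow> ('b, 'd) monoid_scheme \<Rightarrow> bool" where
  "embeds G H \<longleftrightarrow> mon G H \<noteq> {}"

definition markov_property :: "(nat monoid \<Rightarrow> bool) \<Rightarrow> bool" where
  "markov_property \<rho> \<longleftrightarrow> algebraic_property \<rho> \<and>
    (\<exists>G\<^sub>p G\<^sub>m. finitely_presented G\<^sub>p \<and> finitely_presented G\<^sub>m \<and>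
      \<rho> G\<^sub>p \<and> \<not> \<rho> G\<^sub>m \<and>
      (\<forall>K. finitely_presented K \<and> \<rho> K \<longrightarrow> \<not> embeds G\<^sub>m K))"

definition co_markov_property :: "(nat monoid \<Rightarrow> bool) \<Rightarrow> bool" where
  "co_markov_property \<rho> \<longleftrightarrow> markov_property (\<lambda>G. \<not> \<rho> G)"

text \<open>Being finitely annihilated is isomorphism-invariant, so it does not fail to be a Markov or
  co-Markov property merely by violating \<^const>\<open>algebraic_property\<close>.\<close>

lemma algebraic_property_finitely_annihilated: "algebraic_property finitely_annihilated"
  unfolding algebraic_property_def
  by (metis finitely_annihilated_iso_imp finitely_presented_def group.iso_sym)

end

theory Submission
  imports Defs "HOL-Algebra.Elementary_Groups"
begin

text \<open>
  Both halves follow from embedding an arbitrary finitely presented group \<open>G\<close>, first into a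
  finitely presented group that is finitely annihilated and then into one that is not: such
  overgroups rule out every candidate \<open>G\<^sub>-\<close> for the property and for its complement.

  The first overgroup is the free product of \<open>G\<close> with a free group of rank two.  It retracts onto
  \<open>G\<close>, so \<open>G\<close> embeds.  Sending \<open>G\<close> to the identity and the two new generators to a basis of
  \<open>C\<^sub>2 \<times> C\<^sub>2\<close> gives two independent homomorphisms to \<open>C\<^sub>2\<close>, and every element is killed by one of
  them or by their sum.

  The second overgroup \<open>K\<close> is normally generated by a single element \<open>c \<noteq> 1\<close>, so any homomorphism
  that kills \<open>c\<close> is trivial and \<open>c\<close> is not finitely annihilated.  Besides the generators \<open>s\<close> and
  the relators of \<open>G\<close> it has generators \<open>c, a, b, a\<^sub>s, b\<^sub>s\<close> and the relations
  \<open>s = a a\<^sub>s b\<^sub>s b\<close> and \<open>c y c = y c y\<close> for \<open>y\<close> among \<open>a, b, a\<^sub>s, b\<^sub>s\<close>.  If \<open>c = 1\<close>, the last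
  relations read \<open>y = y y\<close>, so each \<open>y\<close> is \<open>1\<close> and therefore each \<open>s\<close> is \<open>1\<close>.

  That \<open>G\<close> embeds in \<open>K\<close>, and that \<open>c \<noteq> 1\<close>, is read off from an action of \<open>K\<close> on a set in which \<open>c\<close>
  moves a point and \<open>G\<close> acts faithfully (\<open>presented_embeds\<close>).  The set consists of copies of \<open>G\<close>, one for each
  of the cells \<open>F n\<close>, \<open>U n\<close>, \<open>V n\<close> with \<open>n \<in> \<nat>\<close>.  The generators \<open>a, b, c\<close> permute the cells:
  \<open>a\<close> swaps \<open>F (n + 1)\<close> with \<open>U n\<close>, \<open>b\<close> swaps \<open>F n\<close> with \<open>U n\<close>, and \<open>c\<close> swaps \<open>U n\<close> with \<open>V n\<close>.
  Writing \<open>d\<close> for the left multiplication by \<open>s\<close> on all cells \<open>F n\<close> with \<open>n > 0\<close>, the generators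
  \<open>a\<^sub>s, b\<^sub>s\<close> act as \<open>d a d\<^sup>-\<^sup>1\<close> and \<open>d b d\<^sup>-\<^sup>1\<close>.  Since \<open>d\<close> commutes with \<open>c\<close>, the braid relations for
  \<open>a\<close> and \<open>b\<close> carry over to \<open>a\<^sub>s\<close> and \<open>b\<^sub>s\<close>.  The product \<open>a a\<^sub>s b\<^sub>s b = (a d a) (b d\<^sup>-\<^sup>1 b)\<close>
  multiplies by \<open>s\<close> on all cells \<open>U n\<close> and by the inverse of \<open>s\<close> on those with \<open>n > 0\<close>.  Only the
  multiplication on \<open>U 0\<close> survives this swindle, and it is a faithful action of \<open>G\<close>.
\<close>

section \<open>Homomorphisms out of a presented group\<close>

definition gen :: "'x set \<Rightarrow> 'x \<Rightarrow> 'x word set" where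
  "gen S x = free_equiv S `` {[(x, True)]}"

definition presented :: "'x set \<Rightarrow> 'x word set set \<Rightarrow> 'x word set set monoid" where
  "presented S R = free_group S Mod normal_closure (free_group S) R"

definition proj :: "'x set \<Rightarrow> 'x word set set \<Rightarrow> 'x word set \<Rightarrow> 'x word set set" where
  "proj S R u = normal_closure (free_group S) R #>\<^bsub>free_group S\<^esub> u"

fun word_value :: "('a, 'b) monoid_scheme \<Rightarrow> ('x \<Rightarrow> 'a) \<Rightarrow> 'x word \<Rightarrow> 'a" where
  "word_value H f [] = \<one>\<^bsub>H\<^esub>"
| "word_value H f ((x, b) # w) = (if b then f x else inv\<^bsub>H\<^esub> f x) \<otimes>\<^bsub>H\<^esub> word_value H f w"

lemma class_in_free_group: "w \<in> words S \<Longrightarrow> free_equiv S `` {w} \<in> carrier (free_group S)"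
  by (auto simp: free_group_def intro: quotientI)

lemma gen_closed [simp]: "x \<in> S \<Longrightarrow> gen S x \<in> carrier (free_group S)"
  unfolding gen_def by (rule class_in_free_group) (simp add: words_def)

context
  fixes H (structure) and S :: "'x set" and f
  assumes H: "group H" and f: "f \<in> S \<rightarrow> carrier H"
begin

lemma word_value_closed: "w \<in> words S \<Longrightarrow> word_value H f w \<in> carrier H"
proof (induction w)
  case Nil
  show ?case using H by (simp add: group.is_monoid)
next
  case (Cons a w)
  interpret H: group H by (rule H)
  from Cons f show ?case by (cases a) (auto simp: words_def)
qed

lemma word_value_append:
  "u \<in> words S \<Longrightarrow> v \<in> words S \<Longrightarrow> word_value H f (u @ v) = word_value H f u \<otimes> word_value H f v"
proof (induction u)
  case Nil
  interpret H: group H by (rule H)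
  show ?case using Nil word_value_closed by simp
next
  case (Cons a u)
  interpret H: group H by (rule H)
  have "u \<in> words S" using Cons.prems by (simp add: words_def)
  moreover have "fst a \<in> S" using Cons.prems by (auto simp: words_def)
  ultimately show ?case
    using Cons word_value_closed f by (cases a) (auto simp: H.m_assoc Pi_iff)
qed

lemma word_value_free_equiv: "(u, v) \<in> free_equiv S \<Longrightarrow> word_value H f u = word_value H f v"
proof (induction rule: free_equiv.induct)
  case (cancel u v x b)
  interpret H: group H by (rule H)
  have fx: "f x \<in> carrier H" using f cancel(3) by auto
  have "[(x, b), (x, \<not> b)] \<in> words S" "[(x, b), (x, \<not> b)] @ v \<in> words S"
    using cancel by (auto simp: words_def)
  moreover have "word_value H f [(x, b), (x, \<not> b)] = \<one>" using fx by simp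
  ultimately show ?case
    using cancel word_value_append word_value_closed by (simp del: append.simps)
qed simp_all

lemma free_group_hom_exists:
  obtains h where "h \<in> hom (free_group S) H" "\<And>x. x \<in> S \<Longrightarrow> h (gen S x) = f x"
proof
  interpret H: group H by (rule H)
  define h where "h A = (THE y. \<exists>w\<in>A. y = word_value H f w)" for A
  have h: "h (free_equiv S `` {w}) = word_value H f w" if "w \<in> words S" for w
    unfolding h_def using that word_value_free_equiv
    by (intro the_equality) (auto intro: free_equiv.refl)
  show "h \<in> hom (free_group S) H"
  proof (rule homI)
    fix A assume "A \<in> carrier (free_group S)"
    then obtain u where u: "u \<in> words S" "A = free_equiv S `` {u}"
      by (auto simp: free_group_def elim: quotientE)
    then show "h A \<in> carrier H" by (simp add: h word_value_closed)
    fix B assume "B \<in> carrier (free_group S)"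
    then obtain v where v: "v \<in> words S" "B = free_equiv S `` {v}"
      by (auto simp: free_group_def elim: quotientE)
    have "u @ v \<in> words S" using u v by (auto simp: words_def)
    then show "h (A \<otimes>\<^bsub>free_group S\<^esub> B) = h A \<otimes> h B"
      using u v by (simp add: free_group_mult_class h word_value_append)
  qed
  show "h (gen S x) = f x" if "x \<in> S" for x
    using that funcset_mem[OF f that] by (simp add: gen_def h words_def)
qed

end

text \<open>The uniqueness half of the universal property; \<open>free_group_hom_exists\<close> is the other half.\<close>

lemma free_group_hom_eqI:
  assumes "group H" "h \<in> hom (free_group S) H" "k \<in> hom (free_group S) H"
    and gens: "\<And>x. x \<in> S \<Longrightarrow> h (gen S x) = k (gen S x)"
    and u: "u \<in> carrier (free_group S)"
  shows "h u = k u"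
proof -
  interpret F: group "free_group S" by (rule group_free_group)
  interpret h: group_hom "free_group S" H h
    using assms by (simp add: group_hom_def group_hom_axioms_def group_free_group)
  interpret k: group_hom "free_group S" H k
    using assms by (simp add: group_hom_def group_hom_axioms_def group_free_group)
  have one: "free_equiv S `` {[]} = \<one>\<^bsub>free_group S\<^esub>" by (simp add: free_group_def)
  have "h (free_equiv S `` {w}) = k (free_equiv S `` {w})" if "w \<in> words S" for w
    using that
  proof (induction w)
    case Nil
    show ?case by (simp add: one)
  next
    case (Cons a w)
    obtain x b where a: "a = (x, b)" by fastforce
    have w: "w \<in> words S" "x \<in> S" "[a] \<in> words S" using Cons.prems a by (auto simp: words_def)
    have inv: "free_equiv S `` {[(x, False)]} = inv\<^bsub>free_group S\<^esub> gen S x"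
    proof (rule F.inv_equality[symmetric])
      have "free_equiv S `` {[(x, False)]} \<otimes>\<^bsub>free_group S\<^esub> gen S x
          = free_equiv S `` {[(x, False), (x, True)]}"
        using w by (simp add: gen_def free_group_mult_class words_def)
      also have "\<dots> = \<one>\<^bsub>free_group S\<^esub>"
        using free_equiv.cancel[of "[]" S "[]" x False] w(2)
        by (simp add: one[symmetric] words_def equiv_class_eq[OF equiv_free_equiv])
      finally show "free_equiv S `` {[(x, False)]} \<otimes>\<^bsub>free_group S\<^esub> gen S x
          = \<one>\<^bsub>free_group S\<^esub>" .
    qed (use w in \<open>auto simp: words_def intro: class_in_free_group\<close>)
    have "h (free_equiv S `` {[a]}) = k (free_equiv S `` {[a]})"
      using gens[OF w(2)] w(2) inv by (cases b) (simp_all add: a flip: gen_def)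
    moreover have "free_equiv S `` {a # w}
        = free_equiv S `` {[a]} \<otimes>\<^bsub>free_group S\<^esub> free_equiv S `` {w}"
      using w by (simp add: free_group_mult_class)
    ultimately show ?case
      using Cons.IH[OF w(1)] class_in_free_group[OF w(1)] class_in_free_group[OF w(3)] by simp
  qed
  with u show ?thesis by (auto simp: free_group_def elim: quotientE)
qed

lemma presented_group:
  assumes "R \<subseteq> carrier (free_group S)"
  shows "group (presented S R)"
  using normal_closure_normal[OF group_free_group assms]
  by (simp add: presented_def normal.factorgroup_is_group)

lemma proj_hom:
  assumes "R \<subseteq> carrier (free_group S)"
  shows "proj S R \<in> hom (free_group S) (presented S R)"
  using normal.r_coset_hom_Mod[OF normal_closure_normal[OF group_free_group assms]]
  by (simp add: presented_def proj_def[abs_def])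

lemma proj_surj:
  assumes "y \<in> carrier (presented S R)"
  obtains u where "u \<in> carrier (free_group S)" "y = proj S R u"
  using assms by (auto simp: presented_def proj_def FactGroup_def RCOSETS_def)

lemma proj_relator:
  assumes R: "R \<subseteq> carrier (free_group S)" and r: "r \<in> R"
  shows "proj S R r = \<one>\<^bsub>presented S R\<^esub>"
proof -
  interpret N: normal "normal_closure (free_group S) R" "free_group S"
    by (rule normal_closure_normal[OF group_free_group R])
  have "r \<in> normal_closure (free_group S) R" using r by (auto simp: normal_closure_def)
  then show ?thesis using N.rcos_const by (simp add: proj_def presented_def FactGroup_def N.is_group)
qed

lemma presented_hom_exists:
  assumes "group H" "R \<subseteq> carrier (free_group S)" "h \<in> hom (free_group S) H"
    and kills: "\<And>r. r \<in> R \<Longrightarrow> h r = \<one>\<^bsub>H\<^esub>"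
  obtains k where "k \<in> hom (presented S R) H"
    "\<And>u. u \<in> carrier (free_group S) \<Longrightarrow> k (proj S R u) = h u"
proof -
  interpret h: group_hom "free_group S" H h
    using assms by (simp add: group_hom_def group_hom_axioms_def group_free_group)
  have "R \<subseteq> kernel (free_group S) H h" using assms(2) kills by (auto simp: kernel_def)
  then have "normal_closure (free_group S) R \<subseteq> kernel (free_group S) H h"
    using h.normal_kernel unfolding normal_closure_def by blast
  from h.FactGroup_universal_kernel[OF normal_closure_normal[OF group_free_group assms(2)] this] that
  show thesis by (auto simp: presented_def proj_def)
qed

lemma presented_hom_trivialI:
  assumes "group H" "R \<subseteq> carrier (free_group S)" "\<phi> \<in> hom (presented S R) H"
    and gens: "\<And>x. x \<in> S \<Longrightarrow> \<phi> (proj S R (gen S x)) = \<one>\<^bsub>H\<^esub>"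
  shows "\<phi> ` carrier (presented S R) = {\<one>\<^bsub>H\<^esub>}"
proof -
  interpret H: group H by fact
  interpret P: group "presented S R" by (rule presented_group[OF assms(2)])
  have "\<phi> \<circ> proj S R \<in> hom (free_group S) H"
    using proj_hom[OF assms(2)] assms(3) by (rule hom_compose)
  moreover have "(\<lambda>u. \<one>\<^bsub>H\<^esub>) \<in> hom (free_group S) H" by (simp add: hom_def)
  ultimately have "(\<phi> \<circ> proj S R) u = \<one>\<^bsub>H\<^esub>" if "u \<in> carrier (free_group S)" for u
    using free_group_hom_eqI[OF assms(1), of "\<phi> \<circ> proj S R" S "\<lambda>u. \<one>\<^bsub>H\<^esub>" u] that gens by simp
  then have "\<phi> y = \<one>\<^bsub>H\<^esub>" if "y \<in> carrier (presented S R)" for y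
    using that by (auto elim: proj_surj)
  then show ?thesis using P.one_closed by force
qed

text \<open>A homomorphism between presented groups is shown to be injective by a concrete
  model \<open>H\<close> of the target relations: it is enough that the source acts faithfully in \<open>H\<close>,
  compatibly on generators.\<close>

lemma presented_embeds:
  assumes H: "group H"
    and R: "R \<subseteq> carrier (free_group S)" and R': "R' \<subseteq> carrier (free_group S')"
    and h: "h \<in> hom (free_group S) (free_group S')" "h ` R \<subseteq> R'"
    and k: "k \<in> hom (free_group S') H" "\<And>r. r \<in> R' \<Longrightarrow> k r = \<one>\<^bsub>H\<^esub>"
    and \<pi>: "\<pi> \<in> mon (presented S R) H"
    and gens: "\<And>x. x \<in> S \<Longrightarrow> k (h (gen S x)) = \<pi> (proj S R (gen S x))"
  shows "embeds (presented S R) (presented S' R')"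
proof -
  have G': "group (presented S' R')" using R' by (rule presented_group)
  have hp: "proj S' R' \<circ> h \<in> hom (free_group S) (presented S' R')"
    using h(1) proj_hom[OF R'] by (rule hom_compose)
  obtain j where j: "j \<in> hom (presented S R) (presented S' R')"
    "\<And>u. u \<in> carrier (free_group S) \<Longrightarrow> j (proj S R u) = proj S' R' (h u)"
  proof (rule presented_hom_exists[OF G' R hp])
    show "(proj S' R' \<circ> h) r = \<one>\<^bsub>presented S' R'\<^esub>" if "r \<in> R" for r
      using that h(2) proj_relator[OF R'] by auto
  qed auto
  obtain \<kappa> where \<kappa>: "\<kappa> \<in> hom (presented S' R') H"
    "\<And>u. u \<in> carrier (free_group S') \<Longrightarrow> \<kappa> (proj S' R' u) = k u"
    using presented_hom_exists[OF H R' k] by auto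
  have \<pi>': "\<pi> \<in> hom (presented S R) H" "inj_on \<pi> (carrier (presented S R))"
    using \<pi> by (auto simp: mon_def)
  have "(k \<circ> h) u = (\<pi> \<circ> proj S R) u" if "u \<in> carrier (free_group S)" for u
    using free_group_hom_eqI[OF H hom_compose[OF h(1) k(1)] hom_compose[OF proj_hom[OF R] \<pi>'(1)]]
      that gens by simp
  then have "\<kappa> (j y) = \<pi> y" if "y \<in> carrier (presented S R)" for y
    using that j(2) \<kappa>(2) h(1) by (auto elim!: proj_surj simp: hom_def Pi_iff)
  then have "inj_on j (carrier (presented S R))"
    using \<pi>'(2) by (metis inj_on_def)
  with j(1) show ?thesis by (auto simp: embeds_def mon_def)
qed

lemma finitely_presented_presented:
  assumes "finite (S :: nat set)" "R \<subseteq> carrier (free_group S)" "finite R"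
  shows "finitely_presented (presented S R)"
  using assms presented_group[OF assms(2)] iso_refl
  unfolding finitely_presented_def presented_def by blast

lemma finitely_presented_elim:
  assumes "finitely_presented G"
  obtains S :: "nat set" and R where "finite S" "R \<subseteq> carrier (free_group S)" "finite R"
    "G \<cong> presented S R"
  using assms unfolding finitely_presented_def presented_def by blast

lemma embeds_iso_cong:
  assumes "G \<cong> P" "embeds P Q" "Q \<cong> K"
  shows "embeds G K"
proof -
  obtain f where "f \<in> mon G P" using assms(1) by (auto simp: is_iso_def iso_iff_mon_epi)
  moreover obtain j where "j \<in> mon P Q" using assms(2) by (auto simp: embeds_def)
  moreover obtain k where "k \<in> mon Q K" using assms(3) by (auto simp: is_iso_def iso_iff_mon_epi)
  ultimately have "k \<circ> (j \<circ> f) \<in> mon G K" by (intro mon_compose)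
  then show ?thesis by (auto simp: embeds_def)
qed


section \<open>Embedding into a finitely annihilated group\<close>

text \<open>If neither of two homomorphisms to \<open>C\<^sub>2\<close> kills an element, then both send it to the generator
  and their sum kills it.  The element \<open>y\<close> witnesses that the sum is not trivial.\<close>

lemma finitely_annihilated_two_homs:
  fixes G (structure)
  assumes G: "group G" and x: "x \<in> carrier G" and y: "y \<in> carrier G"
    and \<alpha>: "\<alpha> \<in> hom G (integer_mod_group 2)" "\<alpha> x \<noteq> 0" "\<alpha> y = 0"
    and \<beta>: "\<beta> \<in> hom G (integer_mod_group 2)" "\<beta> y \<noteq> 0"
  shows "finitely_annihilated G"
proof -
  interpret group G by fact
  let ?C = "integer_mod_group 2"
  define \<gamma> where "\<gamma> z = \<alpha> z \<otimes>\<^bsub>?C\<^esub> \<beta> z" for z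
  have fin: "finite (carrier ?C)" by (simp add: carrier_integer_mod_group)
  have val: "\<alpha> z = 0 \<or> \<alpha> z = 1" "\<beta> z = 0 \<or> \<beta> z = 1" if "z \<in> carrier G" for z
    using that \<alpha>(1) \<beta>(1) by (force simp: hom_def Pi_iff carrier_integer_mod_group)+
  have \<gamma>: "\<gamma> \<in> hom G ?C"
  proof (rule homI)
    show "\<gamma> z \<in> carrier ?C" if "z \<in> carrier G" for z
      by (simp add: \<gamma>_def carrier_integer_mod_group)
    show "\<gamma> (u \<otimes> v) = \<gamma> u \<otimes>\<^bsub>?C\<^esub> \<gamma> v" if "u \<in> carrier G" "v \<in> carrier G" for u v
      using val[OF that(1)] val[OF that(2)] that \<alpha>(1) \<beta>(1) by (auto simp: \<gamma>_def hom_def)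
  qed
  have annihilated: "finitely_annihilated_element G z"
    if "\<phi> \<in> hom G ?C" "\<phi> z = 0" "w \<in> carrier G" "\<phi> w \<noteq> 0" for \<phi> z w
    using that fin G by (intro finitely_annihilated_elementI[of G ?C \<phi>]) auto
  have \<gamma>y: "\<gamma> y \<noteq> 0" using \<alpha>(3) \<beta>(2) val[OF y] by (auto simp: \<gamma>_def)
  have "finitely_annihilated_element G z" if z: "z \<in> carrier G" for z
  proof -
    have "\<alpha> z = 0 \<or> \<beta> z = 0 \<or> \<gamma> z = 0" using val[OF z] by (auto simp: \<gamma>_def)
    then show ?thesis
      using annihilated \<alpha> \<beta> \<gamma> \<gamma>y x y by blast
  qed
  moreover have "carrier G \<noteq> {\<one>}"
    using hom_one[OF \<alpha>(1) G] \<alpha>(2) x by auto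
  ultimately show ?thesis using G by (auto simp: finitely_annihilated_def)
qed

lemma embeds_finitely_annihilated:
  assumes "finitely_presented G"
  shows "\<exists>K :: nat monoid. finitely_presented K \<and> finitely_annihilated K \<and> embeds G K"
proof -
  obtain S :: "nat set" and R where S: "finite S" and R: "R \<subseteq> carrier (free_group S)" "finite R"
    and iso: "G \<cong> presented S R"
    using finitely_presented_elim[OF assms] by metis
  let ?P = "presented S R"
  interpret P: group ?P by (rule presented_group[OF R(1)])
  \<comment> \<open>The generators of \<open>G\<close> are shifted by two to make room for the two new ones, \<open>0\<close> and \<open>1\<close>.\<close>
  define S' where "S' = {0, 1} \<union> (\<lambda>x. x + 2) ` S"
  obtain h where h: "h \<in> hom (free_group S) (free_group S')"
    "\<And>x. x \<in> S \<Longrightarrow> h (gen S x) = gen S' (x + 2)"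
    using free_group_hom_exists[OF group_free_group, of "\<lambda>x. gen S' (x + 2)" S S']
    by (auto simp: S'_def)
  let ?K = "presented S' (h ` R)"
  have R': "h ` R \<subseteq> carrier (free_group S')" using R h(1) by (auto simp: hom_def)
  interpret K: group ?K by (rule presented_group[OF R'])
  have K: "finitely_presented ?K"
    using S R R' by (intro finitely_presented_presented) (auto simp: S'_def)
  have embeds: "embeds ?P ?K"
  proof -
    have pg: "proj S R (gen S x) \<in> carrier ?P" if "x \<in> S" for x
      using proj_hom[OF R(1)] that by (auto simp: hom_def)
    let ?f = "\<lambda>x. if x \<in> {0, 1} then \<one>\<^bsub>?P\<^esub> else proj S R (gen S (x - 2))"
    have "?f \<in> S' \<rightarrow> carrier ?P" using pg by (auto simp: S'_def)
    from free_group_hom_exists[OF P.is_group this] obtain k where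
      k: "k \<in> hom (free_group S') ?P" "\<And>x. x \<in> S' \<Longrightarrow> k (gen S' x) = ?f x"
      by blast
    have gens: "(k \<circ> h) (gen S x) = proj S R (gen S x)" if "x \<in> S" for x
      using that h(2) k(2)[of "x + 2"] by (auto simp: S'_def)
    have kh: "(k \<circ> h) u = proj S R u" if "u \<in> carrier (free_group S)" for u
      using free_group_hom_eqI[OF P.is_group hom_compose[OF h(1) k(1)] proj_hom[OF R(1)] gens that]
      by auto
    show ?thesis
    proof (rule presented_embeds[OF P.is_group R(1) R' h(1) _ k(1)])
      show "k r = \<one>\<^bsub>?P\<^esub>" if "r \<in> h ` R" for r
        using that kh proj_relator[OF R(1)] R(1) by auto
      show "id \<in> mon ?P ?P" by (auto simp: mon_def hom_def)
    qed (use gens in auto)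
  qed
  have to_C2: "\<exists>\<phi>\<in>hom ?K (integer_mod_group 2).
      \<phi> (proj S' (h ` R) (gen S' 0)) = p \<and> \<phi> (proj S' (h ` R) (gen S' 1)) = q"
    if "p \<in> {0, 1}" "q \<in> {0, 1}" for p q :: int
  proof -
    let ?f = "\<lambda>x. if x = 0 then p else if x = 1 then q else 0"
    have "?f \<in> S' \<rightarrow> carrier (integer_mod_group 2)"
      using that by (auto simp: carrier_integer_mod_group)
    from free_group_hom_exists[OF group_integer_mod_group this] obtain k where
      k: "k \<in> hom (free_group S') (integer_mod_group 2)"
      "\<And>x. x \<in> S' \<Longrightarrow> k (gen S' x) = ?f x"
      by blast
    have zero: "(\<lambda>u. 0) \<in> hom (free_group S) (integer_mod_group 2)"
      by (simp add: hom_def carrier_integer_mod_group)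
    have "(k \<circ> h) (gen S x) = 0" if "x \<in> S" for x
      using that h(2) k(2)[of "x + 2"] by (auto simp: S'_def)
    then have "(k \<circ> h) u = 0" if "u \<in> carrier (free_group S)" for u
      using free_group_hom_eqI[OF group_integer_mod_group hom_compose[OF h(1) k(1)] zero _ that]
      by auto
    then have "k r = \<one>\<^bsub>integer_mod_group 2\<^esub>" if "r \<in> h ` R" for r using that R(1) by auto
    with presented_hom_exists[OF group_integer_mod_group R' k(1)] obtain \<phi> where
      "\<phi> \<in> hom ?K (integer_mod_group 2)"
      "\<And>u. u \<in> carrier (free_group S') \<Longrightarrow> \<phi> (proj S' (h ` R) u) = k u"
      by metis
    then show ?thesis using k(2) by (intro bexI[of _ \<phi>]) (auto simp: S'_def)
  qed
  obtain \<alpha> where \<alpha>: "\<alpha> \<in> hom ?K (integer_mod_group 2)"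
    "\<alpha> (proj S' (h ` R) (gen S' 0)) = 1" "\<alpha> (proj S' (h ` R) (gen S' 1)) = 0"
    using to_C2[of 1 0] by auto
  obtain \<beta> where \<beta>: "\<beta> \<in> hom ?K (integer_mod_group 2)"
    "\<beta> (proj S' (h ` R) (gen S' 1)) = 1"
    using to_C2[of 0 1] by auto
  have in_K: "proj S' (h ` R) (gen S' x) \<in> carrier ?K" if "x \<in> S'" for x
    using proj_hom[OF R'] that by (auto simp: hom_def)
  have FA: "finitely_annihilated ?K"
    by (rule finitely_annihilated_two_homs[OF K.is_group in_K[of 0] in_K[of 1] \<alpha>(1) _ \<alpha>(3) \<beta>(1)])
       (simp_all only: \<alpha>(2) \<beta>(2), simp_all add: S'_def)
  obtain L :: "nat monoid" where L: "finitely_presented L" "?K \<cong> L"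
    using finitely_presented_nat_copy[OF K] by blast
  then have "finitely_annihilated L"
    using finitely_annihilated_iso_imp[OF FA] by (auto simp: finitely_presented_def)
  moreover have "embeds G L" using embeds_iso_cong[OF iso embeds L(2)] .
  ultimately show ?thesis using L(1) by blast
qed


section \<open>Permutations of a group times a set of cells\<close>

definition perm_group :: "('x \<Rightarrow> 'x) monoid" where
  "perm_group = \<lparr>carrier = {p. bij p}, mult = (\<circ>), one = id\<rparr>"

lemma perm_group_simps [simp]:
  "carrier perm_group = {p. bij p}" "p \<otimes>\<^bsub>perm_group\<^esub> q = p \<circ> q" "\<one>\<^bsub>perm_group\<^esub> = id"
  by (simp_all add: perm_group_def)

lemma group_perm_group: "group perm_group"
proof (rule groupI)
  fix p :: "'x \<Rightarrow> 'x" assume "p \<in> carrier perm_group"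
  then show "\<exists>q\<in>carrier perm_group. q \<otimes>\<^bsub>perm_group\<^esub> p = \<one>\<^bsub>perm_group\<^esub>"
    by (intro bexI[of _ "inv_into UNIV p"]) (auto simp: bij_imp_bij_inv bij_is_inj)
qed (auto simp: bij_comp o_assoc)

text \<open>\<open>w \<in> D\<close> selects the copies \<open>carrier G \<times> {w}\<close> of the left regular representation; the
  identity off the carrier makes these maps permutations of the whole type.\<close>

definition translate :: "('a, 'b) monoid_scheme \<Rightarrow> 'w set \<Rightarrow> 'a \<Rightarrow> 'a \<times> 'w \<Rightarrow> 'a \<times> 'w" where
  "translate G D g = (\<lambda>(h, w). (if w \<in> D \<and> h \<in> carrier G then g \<otimes>\<^bsub>G\<^esub> h else h, w))"

definition twisted ::
    "('a, 'b) monoid_scheme \<Rightarrow> 'w set \<Rightarrow> 'a \<Rightarrow> ('w \<Rightarrow> 'w) \<Rightarrow> 'a \<times> 'w \<Rightarrow> 'a \<times> 'w" where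
  "twisted G D g p = translate G D g \<circ> map_prod id p \<circ> translate G D (inv\<^bsub>G\<^esub> g)"

context group
begin

lemma translate_mult:
  assumes "g \<in> carrier G" "h \<in> carrier G"
  shows "translate G D (g \<otimes> h) = translate G D g \<circ> translate G D h"
  using assms by (auto simp: translate_def fun_eq_iff m_assoc)

lemma translate_one: "translate G D \<one> = id"
  by (auto simp: translate_def fun_eq_iff)

lemma translate_inv:
  assumes "g \<in> carrier G"
  shows "translate G D g \<circ> translate G D (inv g) = id" "translate G D (inv g) \<circ> translate G D g = id"
  using assms by (simp_all add: translate_one flip: translate_mult)

lemma bij_translate: "g \<in> carrier G \<Longrightarrow> bij (translate G D g)"
  using translate_inv o_bij by blast

lemma translate_mon:
  assumes "w \<in> D"
  shows "translate G D \<in> mon G perm_group"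
proof -
  have "inj_on (translate G D) (carrier G)"
  proof (rule inj_onI)
    fix g h assume gh: "g \<in> carrier G" "h \<in> carrier G" "translate G D g = translate G D h"
    from fun_cong[OF gh(3), of "(\<one>, w)"] gh(1,2) assms show "g = h" by (simp add: translate_def)
  qed
  then show ?thesis by (auto simp: mon_def hom_def bij_translate translate_mult)
qed

lemma twisted_comp:
  assumes "g \<in> carrier G"
  shows "twisted G D g p \<circ> twisted G D g q = twisted G D g (p \<circ> q)"
proof -
  have "twisted G D g p \<circ> twisted G D g q = translate G D g \<circ> map_prod id p \<circ>
      (translate G D (inv g) \<circ> translate G D g) \<circ> map_prod id q \<circ> translate G D (inv g)"
    by (simp add: twisted_def o_assoc)
  also have "\<dots> = twisted G D g (p \<circ> q)"
    using assms by (auto simp: translate_inv twisted_def fun_eq_iff map_prod.compositionality)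
  finally show ?thesis .
qed

lemma twisted_one: "twisted G D \<one> p = map_prod id p"
  by (simp add: twisted_def translate_one)

lemma twisted_fixed:
  assumes "g \<in> carrier G" and fixed: "\<And>w. w \<in> D \<Longrightarrow> p w = w" "\<And>w. p w \<in> D \<Longrightarrow> p w = w"
  shows "twisted G D g p = map_prod id p"
proof -
  have "translate G D g \<circ> map_prod id p = map_prod id p \<circ> translate G D g"
    using fixed by (auto simp: translate_def fun_eq_iff) metis+
  then have "twisted G D g p = map_prod id p \<circ> (translate G D g \<circ> translate G D (inv g))"
    by (simp add: twisted_def o_assoc)
  then show ?thesis using assms(1) by (simp add: translate_inv)
qed

lemma bij_twisted: "g \<in> carrier G \<Longrightarrow> bij p \<Longrightarrow> bij (twisted G D g p)"
  unfolding twisted_def using bij_translate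
  by (intro bij_comp) (auto simp: bij_def prod.inj_map map_prod_surj)

end

datatype cell = F nat | U nat | V nat

fun swap_a :: "cell \<Rightarrow> cell" where
  "swap_a (F 0) = F 0"
| "swap_a (F (Suc n)) = U n"
| "swap_a (U n) = F (Suc n)"
| "swap_a (V n) = V n"

fun swap_b :: "cell \<Rightarrow> cell" where
  "swap_b (F n) = U n"
| "swap_b (U n) = F n"
| "swap_b (V n) = V n"

fun swap_c :: "cell \<Rightarrow> cell" where
  "swap_c (F n) = F n"
| "swap_c (U n) = V n"
| "swap_c (V n) = U n"

text \<open>The tail is fixed pointwise by \<open>swap_c\<close>, while \<open>swap_a\<close> and \<open>swap_b\<close> map it to sets that
  differ in the single cell \<open>U 0\<close>.\<close>

abbreviation (input) tail :: "cell set" where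
  "tail \<equiv> F ` {0<..}"

lemma swap_a_swap_a: "swap_a (swap_a w) = w"
  by (cases w rule: swap_a.cases) simp_all

lemma swap_b_swap_b: "swap_b (swap_b w) = w"
  by (cases w) simp_all

lemma swap_c_swap_c: "swap_c (swap_c w) = w"
  by (cases w) simp_all

lemma bij_swaps: "bij swap_a" "bij swap_b" "bij swap_c"
  by (rule involuntory_imp_bij, simp add: swap_a_swap_a swap_b_swap_b swap_c_swap_c)+

text \<open>On each set \<open>{F (n + 1), U n, V n}\<close>, respectively \<open>{F n, U n, V n}\<close>, the two involutions
  act as adjacent transpositions of three points; hence the braid relations.\<close>

lemma braid_a: "swap_c \<circ> swap_a \<circ> swap_c = swap_a \<circ> swap_c \<circ> swap_a"
proof
  fix w show "(swap_c \<circ> swap_a \<circ> swap_c) w = (swap_a \<circ> swap_c \<circ> swap_a) w"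
    by (cases w rule: swap_a.cases) simp_all
qed

lemma braid_b: "swap_c \<circ> swap_b \<circ> swap_c = swap_b \<circ> swap_c \<circ> swap_b"
proof
  fix w show "(swap_c \<circ> swap_b \<circ> swap_c) w = (swap_b \<circ> swap_c \<circ> swap_b) w"
    by (cases w) simp_all
qed

lemma (in group) twisted_swap_c:
  assumes "g \<in> carrier G"
  shows "twisted G tail g swap_c = map_prod id swap_c"
proof (rule twisted_fixed[OF assms])
  show "swap_c w = w" if "swap_c w \<in> tail" for w using that by (cases w) auto
qed auto

text \<open>As \<open>a\<close> and \<open>b\<close> are involutions, the inner translations cancel and the left-hand side is the
  translation on the image of the tail under \<open>a\<close>, which is all \<open>U n\<close>, times the inverse
  translation on its image under \<open>b\<close>, which is all \<open>U n\<close> with \<open>n > 0\<close>.\<close>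

lemma (in group) swindle:
  assumes g: "g \<in> carrier G"
  shows "map_prod id swap_a \<circ> twisted G tail g swap_a \<circ> twisted G tail g swap_b \<circ> map_prod id swap_b
    = translate G {U 0} g"
proof
  fix x :: "'a \<times> cell"
  obtain h w where x: "x = (h, w)" by fastforce
  show "(map_prod id swap_a \<circ> twisted G tail g swap_a \<circ> twisted G tail g swap_b
      \<circ> map_prod id swap_b) x = translate G {U 0} g x"
  proof (cases w)
    case (F n)
    then show ?thesis
      using g by (cases n) (auto simp: x twisted_def translate_def m_assoc[symmetric])
  next
    case (U n)
    then show ?thesis
      using g by (cases n) (auto simp: x twisted_def translate_def m_assoc[symmetric])
  qed (auto simp: x twisted_def translate_def)
qed


section \<open>Embedding into a group that is not finitely annihilated\<close>

text \<open>\<open>A None\<close> and \<open>B None\<close> are the untwisted generators \<open>a\<close> and \<open>b\<close>, while \<open>A (Some s)\<close> and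
  \<open>B (Some s)\<close> are \<open>a\<^sub>s\<close> and \<open>b\<^sub>s\<close>.\<close>

datatype letter = Old nat | A "nat option" | B "nat option" | C

instance letter :: countable
  by countable_datatype

definition braid_relator :: "('a, 'b) monoid_scheme \<Rightarrow> 'a \<Rightarrow> 'a \<Rightarrow> 'a" where
  "braid_relator G x y = (x \<otimes>\<^bsub>G\<^esub> y \<otimes>\<^bsub>G\<^esub> x) \<otimes>\<^bsub>G\<^esub> inv\<^bsub>G\<^esub> (y \<otimes>\<^bsub>G\<^esub> x \<otimes>\<^bsub>G\<^esub> y)"

definition swindle_relator :: "('a, 'b) monoid_scheme \<Rightarrow> (letter \<Rightarrow> 'a) \<Rightarrow> nat \<Rightarrow> 'a" where
  "swindle_relator G f s =
    (f (A None) \<otimes>\<^bsub>G\<^esub> f (A (Some s)) \<otimes>\<^bsub>G\<^esub> f (B (Some s)) \<otimes>\<^bsub>G\<^esub> f (B None)) \<otimes>\<^bsub>G\<^esub> inv\<^bsub>G\<^esub> f (Old s)"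

lemma (in group) braid_relator_closed [simp]:
  "x \<in> carrier G \<Longrightarrow> y \<in> carrier G \<Longrightarrow> braid_relator G x y \<in> carrier G"
  by (simp add: braid_relator_def)

lemma (in group) braid_relator_one:
  "x \<in> carrier G \<Longrightarrow> y \<in> carrier G \<Longrightarrow> x \<otimes> y \<otimes> x = y \<otimes> x \<otimes> y \<Longrightarrow> braid_relator G x y = \<one>"
  by (simp add: braid_relator_def)

text \<open>With \<open>x = \<one>\<close> the relation \<open>x y x = y x y\<close> becomes \<open>y = y y\<close>.\<close>

lemma (in group) braid_relator_kills:
  assumes "y \<in> carrier G" "braid_relator G \<one> y = \<one>"
  shows "y = \<one>"
  using assms by (simp add: braid_relator_def inv_mult_group m_assoc[symmetric])

lemma (in group_hom) hom_braid_relator: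
  "x \<in> carrier G \<Longrightarrow> y \<in> carrier G \<Longrightarrow> h (braid_relator G x y) = braid_relator H (h x) (h y)"
  by (simp add: braid_relator_def)

lemma embeds_not_finitely_annihilated:
  assumes "finitely_presented G"
  shows "\<exists>K :: nat monoid. finitely_presented K \<and> \<not> finitely_annihilated K \<and> embeds G K"
proof -
  obtain S :: "nat set" and R where S: "finite S" and R: "R \<subseteq> carrier (free_group S)" "finite R"
    and iso: "G \<cong> presented S R"
    using finitely_presented_elim[OF assms] by metis
  let ?P = "presented S R"
  interpret P: group ?P by (rule presented_group[OF R(1)])

  define J where "J = insert None (Some ` S)"
  define letters where "letters = {C} \<union> Old ` S \<union> A ` J \<union> B ` J"
  define S' where "S' = to_nat ` letters"
  define g where "g l = gen S' (to_nat l)" for l :: letter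
  let ?F' = "free_group S'"
  interpret F': group ?F' by (rule group_free_group)
  have fin: "finite J" "finite letters" "finite S'" using S by (auto simp: J_def letters_def S'_def)
  have g_closed [simp]: "g l \<in> carrier ?F'" if "l \<in> letters" for l
    using that by (simp add: g_def S'_def)
  have in_letters [simp]: "C \<in> letters" "s \<in> S \<Longrightarrow> Old s \<in> letters"
    "j \<in> J \<Longrightarrow> A j \<in> letters" "j \<in> J \<Longrightarrow> B j \<in> letters"
    "None \<in> J" "s \<in> S \<Longrightarrow> Some s \<in> J" for s j
    by (auto simp: letters_def J_def)
  obtain h where h: "h \<in> hom (free_group S) ?F'" "\<And>s. s \<in> S \<Longrightarrow> h (gen S s) = g (Old s)"
    using free_group_hom_exists[OF F'.is_group, of "\<lambda>s. g (Old s)" S] by auto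
  define R' where "R' = h ` R \<union> (\<lambda>j. braid_relator ?F' (g C) (g (A j))) ` J
    \<union> (\<lambda>j. braid_relator ?F' (g C) (g (B j))) ` J \<union> swindle_relator ?F' g ` S"
  have R': "R' \<subseteq> carrier ?F'" "finite R'"
    using R S h(1) fin by (auto simp: R'_def hom_def swindle_relator_def)
  let ?K = "presented S' R'"
  have K: "finitely_presented ?K"
    using fin R' by (intro finitely_presented_presented) auto
  interpret K: group ?K by (rule presented_group[OF R'(1)])

  \<comment> \<open>The untwisted generators are the twists by \<open>\<one>\<close>, so \<open>tj\<close> covers all braid relations at once.\<close>
  define t where "t s = proj S R (gen S s)" for s
  define tj where "tj = case_option \<one>\<^bsub>?P\<^esub> t"
  have t [simp]: "t s \<in> carrier ?P" if "s \<in> S" for s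
    using that proj_hom[OF R(1)] by (auto simp: t_def hom_def)
  then have tj: "tj j \<in> carrier ?P" if "j \<in> J" for j
    using that by (auto simp: J_def tj_def)
  define f where "f l = (case l of Old s \<Rightarrow> translate ?P {U 0} (t s)
    | A j \<Rightarrow> twisted ?P tail (tj j) swap_a | B j \<Rightarrow> twisted ?P tail (tj j) swap_b
    | C \<Rightarrow> map_prod id swap_c)" for l
  have C_twisted: "f C = twisted ?P tail (tj j) swap_c" if "j \<in> J" for j
    using P.twisted_swap_c[OF tj[OF that]] by (simp add: f_def)
  have f_A: "f (A j) = twisted ?P tail (tj j) swap_a"
    and f_B: "f (B j) = twisted ?P tail (tj j) swap_b" for j
    by (simp_all add: f_def)
  have f_bij: "bij (f l)" if "l \<in> letters" for l
    using that C_twisted[of None] tj[of None] t bij_swaps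
    by (auto simp: letters_def f_def tj intro!: P.bij_twisted P.bij_translate)
  let ?Q = "perm_group :: (nat word set set \<times> cell \<Rightarrow> _) monoid"
  have "(\<lambda>x. f (from_nat x)) \<in> S' \<rightarrow> carrier ?Q" using f_bij by (auto simp: S'_def)
  from free_group_hom_exists[OF group_perm_group this] obtain k where
    k: "k \<in> hom ?F' ?Q" and k_gen: "\<And>x. x \<in> S' \<Longrightarrow> k (gen S' x) = f (from_nat x)"
    by blast
  have k_g: "k (g l) = f l" if "l \<in> letters" for l
    using that k_gen[of "to_nat l"] by (simp add: S'_def g_def)
  interpret k: group_hom ?F' ?Q k
    using k by (simp add: group_hom_def group_hom_axioms_def group_free_group group_perm_group)
  have translate: "translate ?P {U 0} \<in> mon ?P ?Q" by (rule P.translate_mon) simp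
  then have translate_hom: "translate ?P {U 0} \<in> hom ?P ?Q" by (simp add: mon_def)
  have gens: "(k \<circ> h) (gen S s) = (translate ?P {U 0} \<circ> proj S R) (gen S s)" if "s \<in> S" for s
    using that by (simp add: h(2) k_g f_def t_def)
  have kh: "k (h u) = translate ?P {U 0} (proj S R u)" if "u \<in> carrier (free_group S)" for u
    using free_group_hom_eqI[OF group_perm_group hom_compose[OF h(1) k]
      hom_compose[OF proj_hom[OF R(1)] translate_hom] gens that] by auto
  have k_relator: "k r = \<one>\<^bsub>?Q\<^esub>" if r: "r \<in> R'" for r
  proof -
    consider u where "u \<in> R" "r = h u"
      | j where "j \<in> J" "r = braid_relator ?F' (g C) (g (A j))"
      | j where "j \<in> J" "r = braid_relator ?F' (g C) (g (B j))"
      | s where "s \<in> S" "r = swindle_relator ?F' g s"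
      using r unfolding R'_def by blast
    then show ?thesis
    proof cases
      case 1
      then show ?thesis
        using R(1) proj_relator[OF R(1)] by (auto simp: kh P.translate_one)
    next
      case 2
      have "braid_relator ?Q (f C) (f (A j)) = \<one>\<^bsub>?Q\<^esub>"
      proof (rule group.braid_relator_one[OF group_perm_group])
        show "f C \<otimes>\<^bsub>?Q\<^esub> f (A j) \<otimes>\<^bsub>?Q\<^esub> f C = f (A j) \<otimes>\<^bsub>?Q\<^esub> f C \<otimes>\<^bsub>?Q\<^esub> f (A j)"
          using 2(1) tj by (simp add: C_twisted[OF 2(1)] f_A P.twisted_comp braid_a)
      qed (use 2 f_bij in auto)
      then show ?thesis using 2 by (simp add: k.hom_braid_relator k_g)
    next
      case 3
      have "braid_relator ?Q (f C) (f (B j)) = \<one>\<^bsub>?Q\<^esub>"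
      proof (rule group.braid_relator_one[OF group_perm_group])
        show "f C \<otimes>\<^bsub>?Q\<^esub> f (B j) \<otimes>\<^bsub>?Q\<^esub> f C = f (B j) \<otimes>\<^bsub>?Q\<^esub> f C \<otimes>\<^bsub>?Q\<^esub> f (B j)"
          using 3(1) tj by (simp add: C_twisted[OF 3(1)] f_B P.twisted_comp braid_b)
      qed (use 3 f_bij in auto)
      then show ?thesis using 3 by (simp add: k.hom_braid_relator k_g)
    next
      case 4
      have "f (A None) \<circ> f (A (Some s)) \<circ> f (B (Some s)) \<circ> f (B None) = f (Old s)"
        using 4(1) by (simp add: f_def tj_def P.twisted_one P.swindle)
      then have "k (g (A None) \<otimes>\<^bsub>?F'\<^esub> g (A (Some s)) \<otimes>\<^bsub>?F'\<^esub> g (B (Some s)) \<otimes>\<^bsub>?F'\<^esub> g (B None))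
          = k (g (Old s))"
        using 4(1) by (simp add: k_g)
      then show ?thesis
        using 4 k.H.r_inv[of "k (g (Old s))"] k.hom_closed[of "g (Old s)"]
        by (simp add: swindle_relator_def del: k.hom_mult perm_group_simps)
           (simp del: perm_group_simps)
    qed
  qed
  have embeds: "embeds ?P ?K"
    by (rule presented_embeds[OF group_perm_group R(1) R'(1) h(1) _ k k_relator translate])
       (use gens in \<open>auto simp: R'_def\<close>)

  define c where "c = proj S' R' (g C)"
  have c: "c \<in> carrier ?K" using proj_hom[OF R'(1)] by (auto simp: c_def hom_def)
  have c_ne: "c \<noteq> \<one>\<^bsub>?K\<^esub>"
  proof
    assume "c = \<one>\<^bsub>?K\<^esub>"
    moreover obtain \<kappa> where \<kappa>: "\<kappa> \<in> hom ?K ?Q"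
      "\<And>u. u \<in> carrier ?F' \<Longrightarrow> \<kappa> (proj S' R' u) = k u"
      using presented_hom_exists[OF group_perm_group R'(1) k k_relator] by auto
    ultimately have "k (g C) = \<one>\<^bsub>?Q\<^esub>"
      using hom_one[OF \<kappa>(1) K.is_group group_perm_group] \<kappa>(2)[of "g C"] unfolding c_def by simp
    then have "f C = id" using k_g[of C] by simp
    from fun_cong[OF this, of "(undefined, U 0)"] show False by (simp add: f_def)
  qed

  have not_FA: "\<not> finitely_annihilated ?K"
  proof
    assume "finitely_annihilated ?K"
    then have "finitely_annihilated_element ?K c"
      using c c_ne by (simp add: finitely_annihilated_def)
    then obtain H :: "nat monoid" and \<phi> where H: "group H" and \<phi>: "\<phi> \<in> hom ?K H" "\<phi> c = \<one>\<^bsub>H\<^esub>"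
      and ne: "\<phi> ` carrier ?K \<noteq> {\<one>\<^bsub>H\<^esub>}"
      unfolding finitely_annihilated_element_def by blast
    interpret H: group H by (rule H)
    define \<psi> where "\<psi> = \<phi> \<circ> proj S' R'"
    interpret \<psi>: group_hom ?F' H \<psi>
      using hom_compose[OF proj_hom[OF R'(1)] \<phi>(1)]
      by (simp add: group_hom_def group_hom_axioms_def group_free_group H \<psi>_def)
    have rel: "\<psi> r = \<one>\<^bsub>H\<^esub>" if "r \<in> R'" for r
      using proj_relator[OF R'(1) that] hom_one[OF \<phi>(1) K.is_group H] by (simp add: \<psi>_def)
    have C1: "\<psi> (g C) = \<one>\<^bsub>H\<^esub>" using \<phi>(2) by (simp add: \<psi>_def c_def)
    have A1: "\<psi> (g (A j)) = \<one>\<^bsub>H\<^esub>" if j: "j \<in> J" for j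
    proof (rule H.braid_relator_kills)
      have "braid_relator ?F' (g C) (g (A j)) \<in> R'" using j by (simp add: R'_def)
      from rel[OF this] show "braid_relator H \<one>\<^bsub>H\<^esub> (\<psi> (g (A j))) = \<one>\<^bsub>H\<^esub>"
        using j by (simp add: \<psi>.hom_braid_relator C1)
    qed (use j in simp)
    have B1: "\<psi> (g (B j)) = \<one>\<^bsub>H\<^esub>" if j: "j \<in> J" for j
    proof (rule H.braid_relator_kills)
      have "braid_relator ?F' (g C) (g (B j)) \<in> R'" using j by (simp add: R'_def)
      from rel[OF this] show "braid_relator H \<one>\<^bsub>H\<^esub> (\<psi> (g (B j))) = \<one>\<^bsub>H\<^esub>"
        using j by (simp add: \<psi>.hom_braid_relator C1)
    qed (use j in simp)
    have Old1: "\<psi> (g (Old s)) = \<one>\<^bsub>H\<^esub>" if s: "s \<in> S" for s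
    proof -
      have "swindle_relator ?F' g s \<in> R'" using s by (simp add: R'_def)
      from rel[OF this] show ?thesis
        using s by (simp add: swindle_relator_def A1 B1)
    qed
    have "\<psi> (g l) = \<one>\<^bsub>H\<^esub>" if "l \<in> letters" for l
      using that C1 A1 B1 Old1 by (auto simp: letters_def)
    then have "\<phi> (proj S' R' (gen S' x)) = \<one>\<^bsub>H\<^esub>" if "x \<in> S'" for x
      using that by (auto simp: S'_def g_def \<psi>_def)
    then have "\<phi> ` carrier ?K = {\<one>\<^bsub>H\<^esub>}" by (rule presented_hom_trivialI[OF H R'(1) \<phi>(1)])
    with ne show False by (rule notE)
  qed

  obtain L :: "nat monoid" where L: "finitely_presented L" "?K \<cong> L"
    using finitely_presented_nat_copy[OF K] by blast
  then have "\<not> finitely_annihilated L"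
    using not_FA finitely_annihilated_iso_imp[of L ?K] K.is_group group.iso_sym[OF K.is_group] by blast
  moreover have "embeds G L" using embeds_iso_cong[OF iso embeds L(2)] .
  ultimately show ?thesis using L(1) by blast
qed

theorem corollary4p8:
  shows "\<not> markov_property finitely_annihilated \<and> \<not> co_markov_property finitely_annihilated"
proof
  show "\<not> markov_property finitely_annihilated"
    using embeds_finitely_annihilated unfolding markov_property_def by metis
  show "\<not> co_markov_property finitely_annihilated"
    using embeds_not_finitely_annihilated unfolding co_markov_property_def markov_property_def
    by metis
qed

end
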